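(* Let $A\in\mathbb{R}^{m\times n}$, $b\in\mathbb{R}^m$, let $M\in\mathbb{R}^{n\times n}$ be symmetric positive definite, and let $U=(u_1,\dots,u_m)$, $V=(v_1,\dots,v_n)$, $\sigma_1\geq\dots\geq\sigma_r>0$ be a weighted SVD of $A$ with weight matrix $M$. For the linear least squares problem $\min_{x\in\mathbb{R}^n}\|Ax-b\|_2$, the set of all solutions is $$\mathcal{X}=\sum_{i=1}^{r}\frac{u_i^{\top}b}{\sigma_i}v_i+\mathrm{span}\{v_{r+1},\dots,v_n\},$$ and the unique solution to $$\min_{x\in\mathcal{X}}\|x\|_M,\qquad \mathcal{X}=\Big\{x\in\mathbb{R}^n:\ \|Ax-b\|_2=\min_{z\in\mathbb{R}^n}\|Az-b\|_2\Big\},$$ is $$x_*=\sum_{i=1}^{r}\frac{u_i^{\top}b}{\sigma_i}v_i.$$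
   Context: For $x\in\mathbb{R}^n$, $\|x\|_M:=(x^{\top}Mx)^{1/2}$. Weighted SVD (WSVD) of $A$ with weight matrix $M$: a factorization $U^{\top}AV=\begin{pmatrix}\Sigma_r&\mathbf{0}\\ \mathbf{0}&\mathbf{0}\end{pmatrix}\in\mathbb{R}^{m\times n}$, where $U=(u_1,\dots,u_m)\in\mathbb{R}^{m\times m}$ satisfies $U^{\top}U=I_m$, $V=(v_1,\dots,v_n)\in\mathbb{R}^{n\times n}$ satisfies $V^{\top}MV=I_n$, and $\Sigma_r=\mathrm{diag}(\sigma_1,\dots,\sigma_r)$ with $\sigma_1\geq\dots\geq\sigma_r>0$, $r=\mathrm{rank}(A)$. *)

theory Defs
  imports Complex_Main "Jordan_Normal_Form.DL_Rank"
begin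

definition euclidean_norm :: "real vec \<Rightarrow> real" where
  "euclidean_norm x = sqrt (x \<bullet> x)"

definition weighted_norm :: "real mat \<Rightarrow> real vec \<Rightarrow> real" where
  "weighted_norm M x = sqrt (x \<bullet> (M *\<^sub>v x))"

definition symmetric_positive_definite :: "nat \<Rightarrow> real mat \<Rightarrow> bool" where
  "symmetric_positive_definite n M \<longleftrightarrow>
     M \<in> carrier_mat n n \<and> transpose_mat M = M \<and>
     (\<forall>x \<in> carrier_vec n. x \<noteq> 0\<^sub>v n \<longrightarrow> x \<bullet> (M *\<^sub>v x) > 0)"

(* Indices start at 0: sigma_(i+1), u_(i+1) and v_(i+1) of the usual notation are
   \<sigma> i, col U i and col V i.  Only the values \<sigma> i with i < r matter.
   Equality of the matrix dimensions in the factorization forces r \<le> m and r \<le> n, so the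
   differences m - r and n - r are not truncated. *)
definition weighted_svd ::
  "nat \<Rightarrow> nat \<Rightarrow> real mat \<Rightarrow> real mat \<Rightarrow> real mat \<Rightarrow> real mat \<Rightarrow> (nat \<Rightarrow> real) \<Rightarrow> nat \<Rightarrow> bool"
where
  "weighted_svd m n A M U V \<sigma> r \<longleftrightarrow>
     U \<in> carrier_mat m m \<and> transpose_mat U * U = 1\<^sub>m m \<and>
     V \<in> carrier_mat n n \<and> transpose_mat V * M * V = 1\<^sub>m n \<and>
     transpose_mat U * A * V =
       four_block_mat (mat_diag r \<sigma>) (0\<^sub>m r (n - r))
                      (0\<^sub>m (m - r) r) (0\<^sub>m (m - r) (n - r)) \<and>
     r = vec_space.rank m A \<and>
     (\<forall>i j. i \<le> j \<longrightarrow> j < r \<longrightarrow> \<sigma> j \<le> \<sigma> i) \<and>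
     (\<forall>i < r. 0 < \<sigma> i)"

definition least_squares_solutions :: "nat \<Rightarrow> real mat \<Rightarrow> real vec \<Rightarrow> real vec set" where
  "least_squares_solutions n A b =
     {x. is_arg_min (\<lambda>z. euclidean_norm (A *\<^sub>v z - b)) (\<lambda>z. z \<in> carrier_vec n) x}"

abbreviation vec_span :: "nat \<Rightarrow> real vec set \<Rightarrow> real vec set" where
  "vec_span n \<equiv> LinearCombinations.module.span class_ring (module_vec TYPE(real) n)"

end

theory Submission
  imports Defs
begin

text \<open>The columns of \<open>V\<close> form an \<open>M\<close>-orthonormal basis, so \<open>x = V y\<close> is a change of
  variables with \<open>\<parallel>x\<parallel>\<^sub>M = \<parallel>y\<parallel>\<^sub>2\<close>. As \<open>U\<close> is orthogonal, the squared residual of \<open>V y\<close> is the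
  sum of \<open>(\<sigma>\<^sub>i y\<^sub>i - u\<^sub>i\<^sup>T b)\<^sup>2\<close> over \<open>i \<le> r\<close> plus a constant. Hence the minimizers are the \<open>V y\<close>
  whose first \<open>r\<close> coordinates are \<open>y\<^sub>i = u\<^sub>i\<^sup>T b / \<sigma>\<^sub>i\<close>, and the one of least \<open>M\<close>-norm has all
  other coordinates zero.\<close>

section \<open>Column sums and column spans as products with a coefficient vector\<close>

text \<open>Padding the coefficients with zeros from index \<open>r\<close> on adds only vanishing
  terms to each entry of the product. This puts the candidate solution in the form
  \<open>V *\<^sub>v y\<close>, where it can be compared with other vectors coordinate by
  coordinate.\<close>

lemma finsum_smult_cols:
  fixes V :: "real mat"
  assumes V: "V \<in> carrier_mat n k" and r: "r \<le> k"
  shows "finsum_vec TYPE(real) n (\<lambda>i. f i \<cdot>\<^sub>v col V i) {0..<r}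
           = V *\<^sub>v vec k (\<lambda>i. if i < r then f i else 0)" (is "?l = ?R")
proof (rule eq_vecI)
  have cl: "(\<lambda>i. f i \<cdot>\<^sub>v col V i) \<in> {0..<r} \<rightarrow> carrier_vec n"
    using V by auto
  have "?l \<in> carrier_vec n"
    by (rule finsum_vec_closed[OF cl])
  then show "dim_vec ?l = dim_vec ?R"
    using V by auto
  fix i assume "i < dim_vec ?R"
  then have i: "i < n"
    using V by auto
  have "?l $ i = (\<Sum>j<r. f j * V $$ (i, j))"
    unfolding index_finsum_vec[OF finite_atLeastLessThan i cl]
    using V r i by (intro sum.cong) auto
  also have "\<dots> = (\<Sum>j<k. V $$ (i, j) * (if j < r then f j else 0))"
    using r by (intro sum.mono_neutral_cong_left) auto
  also have "\<dots> = ?R $ i"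
    using V i by (auto simp: scalar_prod_def intro!: sum.cong)
  finally show "?l $ i = ?R $ i" .
qed

text \<open>The columns from \<open>r\<close> on form a matrix \<open>W\<close> whose column space
  is the span. Products with \<open>W\<close> are products with \<open>V\<close> whose coefficient
  vector starts with \<open>r\<close> zeros; the two coefficient vectors differ by an index shift of
  \<open>r\<close>.\<close>

lemma span_tail_cols:
  fixes V :: "real mat"
  assumes V: "V \<in> carrier_mat n k" and r: "r \<le> k"
  shows "vec_span n {col V i | i. r \<le> i \<and> i < k}
           = {V *\<^sub>v y | y. y \<in> carrier_vec k \<and> (\<forall>i<r. y $ i = 0)}"
proof -
  interpret vec_space "TYPE(real)" n .
  define W where "W = mat n (k - r) (\<lambda>(i, j). V $$ (i, j + r))"
  have W: "W \<in> carrier_mat n (k - r)"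
    by (simp add: W_def)
  have colW: "col W j = col V (j + r)" if "j < k - r" for j
    using that V by (intro eq_vecI) (auto simp: W_def)
  have "set (cols W) = (\<lambda>j. col V (j + r)) ` {0..<k - r}"
    using W colW by (auto simp: cols_def)
  also have "\<dots> = {col V i | i. r \<le> i \<and> i < k}"
  proof (intro equalityI subsetI)
    fix x assume "x \<in> {col V i | i. r \<le> i \<and> i < k}"
    then obtain i where "x = col V i" "r \<le> i" "i < k" by auto
    then show "x \<in> (\<lambda>j. col V (j + r)) ` {0..<k - r}"
      by (intro image_eqI[of _ _ "i - r"]) auto
  qed auto
  finally have "vec_span n {col V i | i. r \<le> i \<and> i < k} = col_space W"
    by (simp add: col_space_def)
  also have "\<dots> = {W *\<^sub>v z | z. z \<in> carrier_vec (k - r)}"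
    using W by (auto simp: col_space_eq[OF W])
  finally have span: "vec_span n {col V i | i. r \<le> i \<and> i < k}
      = {W *\<^sub>v z | z. z \<in> carrier_vec (k - r)}" .
  have mult: "W *\<^sub>v vec (k - r) (\<lambda>i. y $ (i + r)) = V *\<^sub>v y"
    if y: "y \<in> carrier_vec k" "\<forall>i<r. y $ i = 0" for y
  proof (rule eq_vecI)
    fix i assume "i < dim_vec (V *\<^sub>v y)"
    then have i: "i < n" using V by auto
    have "(V *\<^sub>v y) $ i = (\<Sum>j\<in>{0..<k}. V $$ (i, j) * y $ j)"
      using V i y by (auto simp: scalar_prod_def intro!: sum.cong)
    also have "\<dots> = (\<Sum>j\<in>{r..<k}. V $$ (i, j) * y $ j)"
      using y by (intro sum.mono_neutral_right) auto
    also have "\<dots> = (\<Sum>j\<in>{0..<k - r}. V $$ (i, j + r) * y $ (j + r))"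
      using r sum.shift_bounds_nat_ivl[of "\<lambda>j. V $$ (i, j) * y $ j" 0 r "k - r"] by simp
    also have "\<dots> = (W *\<^sub>v vec (k - r) (\<lambda>i. y $ (i + r))) $ i"
      using W i by (auto simp: scalar_prod_def W_def intro!: sum.cong)
    finally show "(W *\<^sub>v vec (k - r) (\<lambda>i. y $ (i + r))) $ i = (V *\<^sub>v y) $ i" ..
  qed (use V W in auto)
  show ?thesis
    unfolding span
  proof (intro equalityI subsetI)
    fix x assume "x \<in> {W *\<^sub>v z | z. z \<in> carrier_vec (k - r)}"
    then obtain z where z: "x = W *\<^sub>v z" "z \<in> carrier_vec (k - r)" by auto
    \<comment> \<open>Putting \<open>r\<close> zeros in front of \<open>z\<close> inverts the shift
      in \<open>mult\<close>.\<close>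
    define y where "y = vec k (\<lambda>i. if i < r then 0 else z $ (i - r))"
    have y: "y \<in> carrier_vec k" "\<forall>i<r. y $ i = 0"
      using r by (auto simp: y_def)
    have "vec (k - r) (\<lambda>i. y $ (i + r)) = z"
      using z by (intro eq_vecI) (auto simp: y_def)
    with mult[OF y] z y show "x \<in> {V *\<^sub>v y | y. y \<in> carrier_vec k \<and> (\<forall>i<r. y $ i = 0)}"
      by auto
  next
    fix x assume "x \<in> {V *\<^sub>v y | y. y \<in> carrier_vec k \<and> (\<forall>i<r. y $ i = 0)}"
    then obtain y where y: "x = V *\<^sub>v y" "y \<in> carrier_vec k" "\<forall>i<r. y $ i = 0" by auto
    with mult[OF y(2,3)] show "x \<in> {W *\<^sub>v z | z. z \<in> carrier_vec (k - r)}"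
      by (metis (mono_tags, lifting) mem_Collect_eq vec_carrier)
  qed
qed

section \<open>Norms and coordinates with respect to U and V\<close>

text \<open>For a square matrix the left inverse is also a right inverse, so multiplying by the
  transpose of \<open>U\<close> and then by \<open>U\<close> gives \<open>w\<close> back. Moving one
  factor across the scalar product then yields the claim.\<close>

lemma orthogonal_transpose_scalar_prod:
  fixes U :: "real mat"
  assumes U: "U \<in> carrier_mat m m" and orth: "transpose_mat U * U = 1\<^sub>m m"
    and w: "w \<in> carrier_vec m"
  shows "(transpose_mat U *\<^sub>v w) \<bullet> (transpose_mat U *\<^sub>v w) = w \<bullet> w"
proof -
  have Ut: "transpose_mat U \<in> carrier_mat m m" using U by simp
  have "U * transpose_mat U = 1\<^sub>m m"
    by (rule mat_mult_left_right_inverse[OF Ut U orth])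
  then have "U *\<^sub>v (transpose_mat U *\<^sub>v w) = w"
    using assoc_mult_mat_vec[OF U Ut w] w by simp
  then show ?thesis
    using transpose_vec_mult_scalar[OF U, of "transpose_mat U *\<^sub>v w" w] Ut w by simp
qed

text \<open>Inserting the identity \<open>transpose_mat V * M * V\<close> into
  \<open>y \<bullet> y\<close> and moving the transpose to the other argument produces the quadratic
  form of \<open>M\<close> at \<open>V *\<^sub>v y\<close>.\<close>

lemma weighted_norm_mult_orthonormal:
  assumes M: "M \<in> carrier_mat n n" and V: "V \<in> carrier_mat n n"
    and orth: "transpose_mat V * M * V = 1\<^sub>m n" and y: "y \<in> carrier_vec n"
  shows "weighted_norm M (V *\<^sub>v y) = sqrt (\<Sum>i<n. (y $ i)\<^sup>2)"
proof -
  have Vt: "transpose_mat V \<in> carrier_mat n n" using V by simp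
  have Vy: "V *\<^sub>v y \<in> carrier_vec n" by (rule mult_mat_vec_carrier[OF V y])
  have MVy: "M *\<^sub>v (V *\<^sub>v y) \<in> carrier_vec n" by (rule mult_mat_vec_carrier[OF M Vy])
  have "y = (transpose_mat V * M * V) *\<^sub>v y"
    using orth y by simp
  also have "\<dots> = transpose_mat V *\<^sub>v (M *\<^sub>v (V *\<^sub>v y))"
    using assoc_mult_mat_vec[of "transpose_mat V * M" n n V n y]
      assoc_mult_mat_vec[OF Vt M Vy] Vt M V y by simp
  finally have "y \<bullet> y = (M *\<^sub>v (V *\<^sub>v y)) \<bullet> (V *\<^sub>v y)"
    using transpose_vec_mult_scalar[OF V y MVy] by simp
  also have "\<dots> = (V *\<^sub>v y) \<bullet> (M *\<^sub>v (V *\<^sub>v y))"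
    by (rule comm_scalar_prod[OF MVy Vy])
  finally show ?thesis
    using y by (simp add: weighted_norm_def scalar_prod_def power2_eq_square lessThan_atLeast0)
qed

text \<open>Row \<open>i\<close> has at most one nonzero entry, the diagonal one, so the sum
  defining the product collapses to a single term.\<close>

lemma four_block_diag_mult_vec_index:
  fixes y :: "real vec"
  assumes y: "y \<in> carrier_vec n" and r: "r \<le> n" and i: "i < m"
  shows "(four_block_mat (mat_diag r \<sigma>) (0\<^sub>m r (n - r)) (0\<^sub>m (m - r) r) (0\<^sub>m (m - r) (n - r)) *\<^sub>v y) $ i
           = (if i < r then \<sigma> i * y $ i else 0)"
proof -
  let ?D = "four_block_mat (mat_diag r \<sigma>) (0\<^sub>m r (n - r)) (0\<^sub>m (m - r) r) (0\<^sub>m (m - r) (n - r))"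
  have dim: "i < dim_row ?D" "dim_col ?D = n"
    using r i by (auto simp: mat_diag_def)
  have entry: "?D $$ (i, j) = (if j = i then if i < r then \<sigma> i else 0 else 0)" if "j < n" for j
    using that r i by (simp add: mat_diag_def)
  have "(?D *\<^sub>v y) $ i = (\<Sum>j<n. ?D $$ (i, j) * y $ j)"
    using dim y by (simp add: scalar_prod_def lessThan_atLeast0 del: index_mat_four_block)
  also have "\<dots> = (\<Sum>j<n. if j = i then if i < r then \<sigma> i * y $ i else 0 else 0)"
    by (rule sum.cong) (simp_all add: entry del: index_mat_four_block)
  also have "\<dots> = (if i < r then \<sigma> i * y $ i else 0)"
    using r by (simp add: sum.delta)
  finally show ?thesis .
qed

text \<open>Multiplying the residual by the transpose of \<open>U\<close> keeps its norm and
  decouples the unknowns: coordinate \<open>i\<close> involves only \<open>y $ i\<close> if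
  \<open>i < r\<close>, and no unknown at all otherwise.\<close>

lemma residual_norm_weighted_svd:
  fixes A U V :: "real mat"
  assumes A: "A \<in> carrier_mat m n" and b: "b \<in> carrier_vec m"
    and U: "U \<in> carrier_mat m m" and orth: "transpose_mat U * U = 1\<^sub>m m"
    and V: "V \<in> carrier_mat n n"
    and fact: "transpose_mat U * A * V =
       four_block_mat (mat_diag r \<sigma>) (0\<^sub>m r (n - r)) (0\<^sub>m (m - r) r) (0\<^sub>m (m - r) (n - r))"
    and r: "r \<le> m" "r \<le> n" and y: "y \<in> carrier_vec n"
  shows "euclidean_norm (A *\<^sub>v (V *\<^sub>v y) - b) =
    sqrt ((\<Sum>i<r. (\<sigma> i * y $ i - col U i \<bullet> b)\<^sup>2) + (\<Sum>i\<in>{r..<m}. (col U i \<bullet> b)\<^sup>2))"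
proof -
  have Ut: "transpose_mat U \<in> carrier_mat m m" using U by simp
  have Vy: "V *\<^sub>v y \<in> carrier_vec n" by (rule mult_mat_vec_carrier[OF V y])
  have AVy: "A *\<^sub>v (V *\<^sub>v y) \<in> carrier_vec m" by (rule mult_mat_vec_carrier[OF A Vy])
  have "transpose_mat U *\<^sub>v (A *\<^sub>v (V *\<^sub>v y)) = (transpose_mat U * A * V) *\<^sub>v y"
    by (simp only: assoc_mult_mat_vec[OF mult_carrier_mat[OF Ut A] V y] assoc_mult_mat_vec[OF Ut A Vy])
  then have comp: "(transpose_mat U *\<^sub>v (A *\<^sub>v (V *\<^sub>v y) - b)) $ i =
      (if i < r then \<sigma> i * y $ i else 0) - col U i \<bullet> b" if "i < m" for i
    using four_block_diag_mult_vec_index[OF y r(2) that] fact that U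
    by (simp add: mult_minus_distrib_mat_vec[OF Ut AVy b])
  define w where "w = A *\<^sub>v (V *\<^sub>v y) - b"
  have w: "w \<in> carrier_vec m" using AVy b by (simp add: w_def)
  have "w \<bullet> w = (\<Sum>i<m. ((transpose_mat U *\<^sub>v w) $ i)\<^sup>2)"
    using orthogonal_transpose_scalar_prod[OF U orth w] U
    by (simp add: scalar_prod_def[of "transpose_mat U *\<^sub>v w"] power2_eq_square lessThan_atLeast0)
  also have "\<dots> = (\<Sum>i<m. ((if i < r then \<sigma> i * y $ i else 0) - col U i \<bullet> b)\<^sup>2)"
    using comp by (intro sum.cong) (auto simp: w_def)
  also have "{..<m} = {..<r} \<union> {r..<m}" using r by auto
  also have "(\<Sum>i\<in>{..<r} \<union> {r..<m}. ((if i < r then \<sigma> i * y $ i else 0) - col U i \<bullet> b)\<^sup>2)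
      = (\<Sum>i<r. (\<sigma> i * y $ i - col U i \<bullet> b)\<^sup>2) + (\<Sum>i\<in>{r..<m}. (col U i \<bullet> b)\<^sup>2)"
    by (subst sum.union_disjoint) auto
  finally show ?thesis
    by (simp add: euclidean_norm_def w_def)
qed

text \<open>The product \<open>transpose_mat V * M\<close> is a left inverse of the square matrix
  \<open>V\<close>, hence also a right inverse; applied to \<open>x\<close> it gives the
  coordinates.\<close>

lemma weighted_svd_coordinates:
  fixes M V :: "real mat"
  assumes M: "M \<in> carrier_mat n n" and V: "V \<in> carrier_mat n n"
    and orth: "transpose_mat V * M * V = 1\<^sub>m n" and x: "x \<in> carrier_vec n"
  obtains y where "y \<in> carrier_vec n" "x = V *\<^sub>v y"
proof -
  have VtM: "transpose_mat V * M \<in> carrier_mat n n" using V M by simp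
  have "V * (transpose_mat V * M) = 1\<^sub>m n"
    by (rule mat_mult_left_right_inverse[OF VtM V orth])
  then have "x = V *\<^sub>v ((transpose_mat V * M) *\<^sub>v x)"
    using assoc_mult_mat_vec[OF V VtM x] x by simp
  with VtM x show ?thesis
    by (intro that[of "(transpose_mat V * M) *\<^sub>v x"]) auto
qed

text \<open>With truncated subtraction, \<open>r + (m - r)\<close> is the maximum of
  \<open>r\<close> and \<open>m\<close>. It is the row count of the block matrix, which must be
  \<open>m\<close>; the columns are treated alike.\<close>

lemma weighted_svd_rank_le:
  assumes "A \<in> carrier_mat m n" and "weighted_svd m n A M U V \<sigma> r"
  shows "r \<le> m" "r \<le> n"
proof -
  let ?D = "four_block_mat (mat_diag r \<sigma>) (0\<^sub>m r (n - r)) (0\<^sub>m (m - r) r) (0\<^sub>m (m - r) (n - r))"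
  have U: "U \<in> carrier_mat m m" and V: "V \<in> carrier_mat n n" and eq: "transpose_mat U * A * V = ?D"
    using assms(2) by (auto simp: weighted_svd_def)
  have "dim_row ?D = m" "dim_col ?D = n"
    unfolding eq[symmetric] using U V by auto
  then show "r \<le> m" "r \<le> n"
    by (auto simp: mat_diag_def)
qed

section \<open>Minimizers of the residual\<close>

text \<open>The residual norm at \<open>V *\<^sub>v y\<close> is \<open>sqrt (S y + K)\<close> with
  \<open>K\<close> constant and \<open>S\<close> a sum of squares that attains 0, so minimizing it
  means \<open>S y = 0\<close>.\<close>

lemma least_squares_solutions_weighted_svd:
  assumes A: "A \<in> carrier_mat m n" and b: "b \<in> carrier_vec m"
    and M: "M \<in> carrier_mat n n" and svd: "weighted_svd m n A M U V \<sigma> r"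
  shows "least_squares_solutions n A b =
    {V *\<^sub>v y | y. y \<in> carrier_vec n \<and> (\<forall>i<r. y $ i = (col U i \<bullet> b) / \<sigma> i)}"
proof -
  note r = weighted_svd_rank_le[OF A svd]
  have V: "V \<in> carrier_mat n n" and orthV: "transpose_mat V * M * V = 1\<^sub>m n"
    and pos: "\<And>i. i < r \<Longrightarrow> 0 < \<sigma> i"
    using svd by (auto simp: weighted_svd_def)
  define c where "c i = col U i \<bullet> b" for i
  define S where "S y = (\<Sum>i<r. (\<sigma> i * y $ i - c i)\<^sup>2)" for y :: "real vec"
  define K where "K = (\<Sum>i\<in>{r..<m}. (c i)\<^sup>2)"
  have res: "euclidean_norm (A *\<^sub>v (V *\<^sub>v y) - b) = sqrt (S y + K)" if "y \<in> carrier_vec n" for y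
    unfolding S_def K_def c_def
    by (rule residual_norm_weighted_svd[OF A b _ _ V _ r that])
      (use svd in \<open>auto simp: weighted_svd_def\<close>)
  have S_nonneg: "0 \<le> S y" for y
    by (simp add: S_def sum_nonneg)
  have S_zero: "S y = 0 \<longleftrightarrow> (\<forall>i<r. y $ i = c i / \<sigma> i)" for y
  proof -
    have "S y = 0 \<longleftrightarrow> (\<forall>i<r. \<sigma> i * y $ i = c i)"
      by (auto simp: S_def sum_nonneg_eq_0_iff)
    also have "\<dots> \<longleftrightarrow> (\<forall>i<r. y $ i = c i / \<sigma> i)"
      using pos by (fastforce simp: field_simps)
    finally show ?thesis .
  qed
  \<comment> \<open>A zero of \<open>S\<close>; its entries from \<open>r\<close> on are
    arbitrary.\<close>
  define y0 where "y0 = vec n (\<lambda>i. c i / \<sigma> i)"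
  have y0: "y0 \<in> carrier_vec n" "S y0 = 0"
    using r by (auto simp: y0_def S_zero)
  have argmin: "is_arg_min (\<lambda>z. euclidean_norm (A *\<^sub>v z - b)) (\<lambda>z. z \<in> carrier_vec n) (V *\<^sub>v y)
      \<longleftrightarrow> S y = 0" if y: "y \<in> carrier_vec n" for y
  proof
    assume "is_arg_min (\<lambda>z. euclidean_norm (A *\<^sub>v z - b)) (\<lambda>z. z \<in> carrier_vec n) (V *\<^sub>v y)"
    \<comment> \<open>A minimizer is not beaten by \<open>V *\<^sub>v y0\<close>, where
      \<open>S\<close> is zero.\<close>
    then have "\<not> sqrt (S y0 + K) < sqrt (S y + K)"
      using res[OF y] res[OF y0(1)] mult_mat_vec_carrier[OF V y0(1)]
      by (metis is_arg_min_def)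
    then show "S y = 0"
      using y0(2) S_nonneg[of y] by simp
  next
    assume 0: "S y = 0"
    \<comment> \<open>Every competitor has coordinates \<open>t\<close> with respect to
      \<open>V\<close>, and \<open>S t\<close> cannot fall below 0.\<close>
    have "\<not> euclidean_norm (A *\<^sub>v z - b) < euclidean_norm (A *\<^sub>v (V *\<^sub>v y) - b)"
      if z: "z \<in> carrier_vec n" for z
    proof -
      obtain t where t: "t \<in> carrier_vec n" "z = V *\<^sub>v t"
        by (rule weighted_svd_coordinates[OF M V orthV z])
      then show ?thesis
        using res[OF y] res[OF t(1)] 0 S_nonneg[of t] by simp
    qed
    then show "is_arg_min (\<lambda>z. euclidean_norm (A *\<^sub>v z - b)) (\<lambda>z. z \<in> carrier_vec n) (V *\<^sub>v y)"
      using V y by (auto simp: is_arg_min_def)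
  qed
  have "least_squares_solutions n A b = {V *\<^sub>v y | y. y \<in> carrier_vec n \<and> S y = 0}"
  proof (intro equalityI subsetI)
    fix x assume x: "x \<in> least_squares_solutions n A b"
    then have "x \<in> carrier_vec n"
      by (simp add: least_squares_solutions_def is_arg_min_def)
    then obtain y where "y \<in> carrier_vec n" "x = V *\<^sub>v y"
      by (rule weighted_svd_coordinates[OF M V orthV])
    with x argmin show "x \<in> {V *\<^sub>v y | y. y \<in> carrier_vec n \<and> S y = 0}"
      by (auto simp: least_squares_solutions_def)
  next
    fix x assume "x \<in> {V *\<^sub>v y | y. y \<in> carrier_vec n \<and> S y = 0}"
    with argmin show "x \<in> least_squares_solutions n A b"
      by (auto simp: least_squares_solutions_def)
  qed
  then show ?thesis
    by (simp add: S_zero c_def)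
qed

section \<open>The solution set and its element of least M-norm\<close>

theorem theorem3p3:
  fixes m n r :: nat
    and A M U V :: "real mat"
    and b :: "real vec"
    and \<sigma> :: "nat \<Rightarrow> real"
  assumes "A \<in> carrier_mat m n"
    and "b \<in> carrier_vec m"
    and "symmetric_positive_definite n M"
    and "weighted_svd m n A M U V \<sigma> r"
  shows "let \<X> = least_squares_solutions n A b;
             xs = finsum_vec TYPE(real) n (\<lambda>i. ((col U i \<bullet> b) / \<sigma> i) \<cdot>\<^sub>v col V i) {0..<r}
         in \<X> = {xs + w | w. w \<in> vec_span n {col V i | i. r \<le> i \<and> i < n}} \<and>
            {x. is_arg_min (weighted_norm M) (\<lambda>x. x \<in> \<X>) x} = {xs}"
proof -
  note r = weighted_svd_rank_le(2)[OF assms(1,4)]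
  have M: "M \<in> carrier_mat n n"
    using assms(3) by (simp add: symmetric_positive_definite_def)
  have V: "V \<in> carrier_mat n n" and orthV: "transpose_mat V * M * V = 1\<^sub>m n"
    using assms(4) by (auto simp: weighted_svd_def)
  define c where "c i = (col U i \<bullet> b) / \<sigma> i" for i
  define y0 where "y0 = vec n (\<lambda>i. if i < r then c i else 0)"
  define X where "X = {V *\<^sub>v y | y. y \<in> carrier_vec n \<and> (\<forall>i<r. y $ i = c i)}"
  have X: "least_squares_solutions n A b = X"
    unfolding X_def c_def
    by (rule least_squares_solutions_weighted_svd[OF assms(1,2) M assms(4)])
  have xs: "finsum_vec TYPE(real) n (\<lambda>i. ((col U i \<bullet> b) / \<sigma> i) \<cdot>\<^sub>v col V i) {0..<r} = V *\<^sub>v y0"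
    unfolding y0_def c_def by (rule finsum_smult_cols[OF V r])
  have y0: "y0 \<in> carrier_vec n" "\<forall>i<r. y0 $ i = c i"
    using r by (auto simp: y0_def)
  \<comment> \<open>Coordinate vectors of two solutions agree below \<open>r\<close>, so their
    difference has \<open>r\<close> leading zeros, which describes the span of the remaining
    columns.\<close>
  have "X = {V *\<^sub>v y0 + w | w. w \<in> vec_span n {col V i | i. r \<le> i \<and> i < n}}"
    unfolding span_tail_cols[OF V r]
  proof (intro equalityI subsetI)
    fix x assume "x \<in> X"
    then obtain y where y: "x = V *\<^sub>v y" "y \<in> carrier_vec n" "\<forall>i<r. y $ i = c i"
      by (auto simp: X_def)
    have d: "y - y0 \<in> carrier_vec n" "\<forall>i<r. (y - y0) $ i = 0"
      using y y0 r by auto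
    have "y0 + (y - y0) = y"
      using y y0 by (intro eq_vecI) auto
    then have "x = V *\<^sub>v y0 + V *\<^sub>v (y - y0)"
      using mult_add_distrib_mat_vec[OF V y0(1) d(1)] y(1) by simp
    with d show "x \<in> {V *\<^sub>v y0 + w | w. w \<in> {V *\<^sub>v y | y. y \<in> carrier_vec n \<and> (\<forall>i<r. y $ i = 0)}}"
      by blast
  next
    fix x assume "x \<in> {V *\<^sub>v y0 + w | w. w \<in> {V *\<^sub>v y | y. y \<in> carrier_vec n \<and> (\<forall>i<r. y $ i = 0)}}"
    then obtain d where d: "x = V *\<^sub>v y0 + V *\<^sub>v d" "d \<in> carrier_vec n" "\<forall>i<r. d $ i = 0"
      by blast
    then have "x = V *\<^sub>v (y0 + d)"
      using mult_add_distrib_mat_vec[OF V y0(1) d(2)] by simp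
    moreover have "y0 + d \<in> carrier_vec n" "\<forall>i<r. (y0 + d) $ i = c i"
      using d y0 r by auto
    ultimately show "x \<in> X"
      unfolding X_def by blast
  qed
  moreover have "{x. is_arg_min (weighted_norm M) (\<lambda>x. x \<in> X) x} = {V *\<^sub>v y0}"
  proof -
    note norm = weighted_norm_mult_orthonormal[OF M V orthV]
    \<comment> \<open>Strict inequality against every other solution gives minimality and uniqueness
      at once.\<close>
    have strict: "weighted_norm M (V *\<^sub>v y0) < weighted_norm M x" if x: "x \<in> X" "x \<noteq> V *\<^sub>v y0" for x
    proof -
      obtain y where y: "x = V *\<^sub>v y" "y \<in> carrier_vec n" "\<forall>i<r. y $ i = c i"
        using x(1) unfolding X_def by blast
      obtain k where k: "k < n" "y $ k \<noteq> y0 $ k"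
        using x(2) y(1,2) y0(1) by (metis carrier_vecD eq_vecI)
      \<comment> \<open>The vectors agree below \<open>r\<close>, hence \<open>r \<le> k\<close>;
        there \<open>y0\<close> is zero and \<open>y\<close> is not, which makes the comparison of
        squares strict at \<open>k\<close>.\<close>
      have "(\<Sum>i<n. (y0 $ i)\<^sup>2) < (\<Sum>i<n. (y $ i)\<^sup>2)"
      proof (rule sum_strict_mono_ex1)
        show "\<forall>i\<in>{..<n}. (y0 $ i)\<^sup>2 \<le> (y $ i)\<^sup>2"
          using y(3) by (auto simp: y0_def)
        show "\<exists>i\<in>{..<n}. (y0 $ i)\<^sup>2 < (y $ i)\<^sup>2"
          using k y(3) by (intro bexI[of _ k]) (auto simp: y0_def split: if_splits)
      qed simp
      then show ?thesis
        using norm[OF y0(1)] norm[OF y(2)] y(1) by simp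
    qed
    have mem: "V *\<^sub>v y0 \<in> X"
      unfolding X_def using y0 by blast
    have "is_arg_min (weighted_norm M) (\<lambda>x. x \<in> X) x \<longleftrightarrow> x = V *\<^sub>v y0" for x
      unfolding is_arg_min_def using strict mem by (metis less_asym less_irrefl)
    then show ?thesis by blast
  qed
  ultimately show ?thesis
    by (simp add: X xs)
qed

end
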